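(* Let $0\le p<q$ be integers and let $\vec a\in(-1,\infty)^p$, $\vec b\in(-1,\infty)^q$ satisfy $a_j<b_j$ for $1\le j\le p$. Let $\vec n\in\mathbb Z_{\ge0}^q$ be a multi-index near the diagonal with $|\vec n|\ge1$, and suppose that $b_j-a_i\notin\mathbb Z_{<0}$ and $b_i-b_j\notin\mathbb Z_{\ge0}$ whenever $i\ne j$. Let $(A_{\vec n,1},\dots,A_{\vec n,q})$ be the type I polynomials for the weights $(w_1,\dots,w_q)$ on the unit circle, normalized so that $F_{\vec n}=\sum_{j=1}^qA_{\vec n,j}w_j$ satisfies $\frac1{2\pi i}\int_{|z|=1}z^{s-1}F_{\vec n}(z)dz=\frac{\Gamma(s+\vec a)}{\Gamma(s+\vec b+\vec n)}(1-s)_{|\vec n|-1}$ for all integers $s\ge1$. Then, for $1\le j\le q$, $$A_{\vec n,j}(z)=\frac{(\vec a-b_j)_1}{(\vec b^{\ast j}-b_j)_1}\sum_{J=1}^q\sum_{K=0}^{n_J-1}P_{\vec n,J}[K]\sum_{k=0}^{K-1+\delta_{j,J}}\frac{(\vec b^{\ast j}-b_J-K)_{k+1}\,(b_j-b_J-K)_k}{(\vec a-b_J-K)_{k+1}}\,z^k,$$ where $$P_{\vec n,J}[K]=\frac{(b_J+K+1)_{|\vec n|-1}}{\prod_{i=1,i\ne J}^q(b_i-b_J-K)_{n_i}}\,\frac{(-1)^K}{K!\,(n_J-K-1)!}.$$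
   Context: Conventions: for a vector $\vec s$, $\Gamma(\vec s)=\prod_j\Gamma(s_j)$ and $(\vec s)_k=\prod_j(s_j)_k$ (equal to $1$ for the empty vector), with $(s)_k=\prod_{i=0}^{k-1}(s+i)$; adding a scalar to a vector means adding it to each component; empty sums are $0$. $\vec b^{\ast j}=(b_1,\dots,b_{j-1},b_{j+1},\dots,b_q)$. $\delta_{j,J}$ is the Kronecker delta; $|\vec n|=n_1+\dots+n_q$; $\vec e_j$ is the $j$-th unit vector. A multi-index is near the diagonal if $|n_i-n_j|\le1$ for all $i,j$. If $b_j=a_i$ for some $i\ne j$, the zero factor of $(\vec a-b_j)_1$ is understood to be cancelled against the same factor in $(\vec a-b_j-K)_{K+1}$ in the terms with $J=j$, $k=K$. Weights: $w_j(z)=\sum_{k\ge0}\frac{\Gamma(k+\vec a+1)}{\Gamma(k+\vec b+\vec e_j+1)}z^{-k-1}$ for $z\in\mathbb C\setminus\{0\}$, $1\le j\le q$. Type I polynomials for $\vec n$: real polynomials with $\deg A_{\vec n,j}\le n_j-1$ ($A_{\vec n,j}=0$ if $n_j=0$) such that $F_{\vec n}=\sum_jA_{\vec n,j}w_j$ satisfies $\int_{|z|=1}F_{\vec n}(z)z^kdz=0$ for $k=0,\dots,|\vec n|-2$ (circle positively oriented). The moments $\frac1{2\pi i}\int_{|z|=1}z^{s-1}F_{\vec n}(z)dz$ of any such $F_{\vec n}$ are a constant (independent of $s$) times $\frac{\Gamma(s+\vec a)}{\Gamma(s+\vec b+\vec n)}(1-s)_{|\vec n|-1}$; the normalization takes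 this constant to be $1$. *)

theory Defs
  imports "HOL-Complex_Analysis.Complex_Analysis"
begin

text \<open>
  Vectors \<open>s = (s\<^sub>1, \<dots>, s\<^sub>m)\<close> are functions on \<^typ>\<open>nat\<close> of which only the values on the index set
  \<open>{1..m}\<close> matter. The index set is an explicit argument, so that the vector \<open>b\<close> with its
  \<open>j\<close>-th component removed is \<open>b\<close> on the index set \<open>{1..q} - {j}\<close>.
\<close>

definition vGamma :: "nat set \<Rightarrow> (nat \<Rightarrow> real) \<Rightarrow> real" where
  "vGamma I s = (\<Prod>i\<in>I. Gamma (s i))"

definition vpoch :: "nat set \<Rightarrow> (nat \<Rightarrow> real) \<Rightarrow> nat \<Rightarrow> real" where
  "vpoch I s k = (\<Prod>i\<in>I. pochhammer (s i) k)"

definition kdelta :: "nat \<Rightarrow> nat \<Rightarrow> nat" where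
  "kdelta i j = (if i = j then 1 else 0)"

definition msize :: "nat \<Rightarrow> (nat \<Rightarrow> nat) \<Rightarrow> nat" where
  "msize q n = (\<Sum>i=1..q. n i)"

definition near_diagonal :: "nat \<Rightarrow> (nat \<Rightarrow> nat) \<Rightarrow> bool" where
  "near_diagonal q n \<longleftrightarrow> (\<forall>i\<in>{1..q}. \<forall>j\<in>{1..q}. \<bar>int (n i) - int (n j)\<bar> \<le> 1)"

text \<open>Meaningful for \<open>z \<noteq> 0\<close> only; there the series converges, because \<open>p < q\<close>.\<close>

definition weight ::
  "nat \<Rightarrow> nat \<Rightarrow> (nat \<Rightarrow> real) \<Rightarrow> (nat \<Rightarrow> real) \<Rightarrow> nat \<Rightarrow> complex \<Rightarrow> complex" where
  "weight p q a b j z =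
     (\<Sum>k. complex_of_real
        (vGamma {1..p} (\<lambda>i. real k + a i + 1) /
         vGamma {1..q} (\<lambda>i. real k + b i + real (kdelta i j) + 1)) / z ^ (k + 1))"

definition type_I_form ::
  "nat \<Rightarrow> nat \<Rightarrow> (nat \<Rightarrow> real) \<Rightarrow> (nat \<Rightarrow> real) \<Rightarrow> (nat \<Rightarrow> real poly) \<Rightarrow> complex \<Rightarrow> complex" where
  "type_I_form p q a b A z =
     (\<Sum>j=1..q. poly (map_poly complex_of_real (A j)) z * weight p q a b j z)"

definition type_I ::
  "nat \<Rightarrow> nat \<Rightarrow> (nat \<Rightarrow> real) \<Rightarrow> (nat \<Rightarrow> real) \<Rightarrow> (nat \<Rightarrow> nat) \<Rightarrow> (nat \<Rightarrow> real poly) \<Rightarrow> bool" where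
  "type_I p q a b n A \<longleftrightarrow>
     (\<forall>j\<in>{1..q}. degree (A j) \<le> n j - 1 \<and> (n j = 0 \<longrightarrow> A j = 0)) \<and>
     (\<forall>k. k + 2 \<le> msize q n \<longrightarrow>
        contour_integral (circlepath 0 1) (\<lambda>z. type_I_form p q a b A z * z ^ k) = 0)"

definition normalized ::
  "nat \<Rightarrow> nat \<Rightarrow> (nat \<Rightarrow> real) \<Rightarrow> (nat \<Rightarrow> real) \<Rightarrow> (nat \<Rightarrow> nat) \<Rightarrow> (nat \<Rightarrow> real poly) \<Rightarrow> bool" where
  "normalized p q a b n A \<longleftrightarrow>
     (\<forall>s::nat. s \<ge> 1 \<longrightarrow>
        1 / (2 * complex_of_real pi * \<i>) *
          contour_integral (circlepath 0 1) (\<lambda>z. z ^ (s - 1) * type_I_form p q a b A z) =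
        complex_of_real
          (vGamma {1..p} (\<lambda>i. real s + a i) / vGamma {1..q} (\<lambda>i. real s + b i + real (n i)) *
           pochhammer (1 - real s) (msize q n - 1)))"

definition coeffP :: "nat \<Rightarrow> (nat \<Rightarrow> real) \<Rightarrow> (nat \<Rightarrow> nat) \<Rightarrow> nat \<Rightarrow> nat \<Rightarrow> real" where
  "coeffP q b n J K =
     pochhammer (b J + real K + 1) (msize q n - 1) /
       (\<Prod>i\<in>{1..q} - {J}. pochhammer (b i - b J - real K) (n i)) *
     ((-1) ^ K / (fact K * fact (n J - K - 1)))"

text \<open>
  The quotient of \<open>(a - b\<^sub>j)\<^sub>1\<close> by \<open>(a - b\<^sub>J - K)\<^sub>k\<^sub>+\<^sub>1\<close>, component by component. If \<open>J = j\<close>, \<open>k = K\<close>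
  and \<open>a\<^sub>i = b\<^sub>j\<close>, numerator and denominator have the common factor \<open>a\<^sub>i - b\<^sub>j = 0\<close>, the denominator
  being \<open>(a\<^sub>i - b\<^sub>j - K)\<^sub>K (a\<^sub>i - b\<^sub>j)\<close>; this factor is cancelled. The other branch is never \<open>0/0\<close>
  for the parameters considered.
\<close>

definition a_quot ::
  "nat \<Rightarrow> (nat \<Rightarrow> real) \<Rightarrow> (nat \<Rightarrow> real) \<Rightarrow> nat \<Rightarrow> nat \<Rightarrow> nat \<Rightarrow> nat \<Rightarrow> real" where
  "a_quot p a b j J K k =
     (\<Prod>i=1..p.
        if J = j \<and> k = K \<and> a i = b j then 1 / pochhammer (a i - b j - real K) K
        else pochhammer (a i - b j) 1 / pochhammer (a i - b J - real K) (k + 1))"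

end

theory Submission
  imports Defs
begin

text \<open>
  Dividing the moment identity by \<open>\<Gamma>(s + a) / \<Gamma>(s + b)\<close> turns it into an identity between rational
  functions of \<open>s\<close>: the coefficients \<open>A\<^sub>j[k]\<close> expand \<open>(1 - s)\<^bsub>|n| - 1\<^esub> / \<Prod>\<^sub>i (s + b\<^sub>i)\<^bsub>n\<^sub>i\<^esub>\<close> in the functions
  \<open>(s + a)\<^sub>k / ((s + b)\<^sub>k (s + b\<^sub>j + k))\<close>. These functions are linearly independent: at \<open>s = - b\<^sub>j - k\<close> the one
  indexed by \<open>(j, k)\<close> is the only one of index at most \<open>k\<close> that has a pole. The residues of the right-hand side
  at \<open>s = - b\<^sub>J - K\<close> are the numbers \<open>P\<^sub>J[K]\<close>, and each \<open>1 / (s + x)\<close> with \<open>x = b\<^sub>J + K\<close> is expanded by telescoping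
  \<open>T\<^sub>k / (s + x)\<close>, \<open>T\<^sub>k = (s + a)\<^sub>k (b - x)\<^sub>k / ((s + b)\<^sub>k (a - x)\<^sub>k)\<close>, which stops since \<open>(b\<^sub>J - x)\<^bsub>K + 1\<^esub> = 0\<close>.
\<close>

section \<open>Partial fractions with simple poles\<close>

text \<open>Lagrange interpolation: \<open>h\<close> is the interpolant of \<open>f\<close> at the
  nodes \<open>x i\<close>. Both have degree below the number of nodes and agree at each node, so
  they coincide; division by the product of all \<open>s - x i\<close> turns each basis polynomial
  \<open>g i\<close> into a simple fraction.\<close>

lemma partial_fraction_expansion:
  fixes f :: "'a::field poly" and x :: "'b \<Rightarrow> 'a"
  assumes fin: "finite S" and inj: "inj_on x S" and deg: "degree f < card S"
    and s: "\<And>i. i \<in> S \<Longrightarrow> s \<noteq> x i"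
  shows "poly f s / (\<Prod>i\<in>S. s - x i) =
    (\<Sum>i\<in>S. poly f (x i) / (\<Prod>l\<in>S - {i}. x i - x l) / (s - x i))"
proof -
  define c where "c i = poly f (x i) / (\<Prod>l\<in>S - {i}. x i - x l)" for i
  define g where "g i = (\<Prod>l\<in>S - {i}. [:- x l, 1:])" for i
  define h where "h = (\<Sum>i\<in>S. smult (c i) (g i))"
  have deg_g: "degree (g i) < card S" if "i \<in> S" for i
  proof -
    have "degree (g i) \<le> (\<Sum>l\<in>S - {i}. degree [:- x l, 1:])"
      unfolding g_def using degree_prod_sum_le[of "S - {i}" "\<lambda>l. [:- x l, 1:]"] fin
      by (simp add: o_def)
    also have "\<dots> = card (S - {i})" by simp
    also have "\<dots> < card S" by (intro card_Diff1_less fin that)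
    finally show ?thesis .
  qed
  have deg_h: "degree h < card S"
    unfolding h_def
  proof (rule degree_sum_less)
    show "0 < card S" using deg by simp
    show "degree (smult (c i) (g i)) < card S" if "i \<in> S" for i
      using deg_g[OF that] degree_smult_le[of "c i" "g i"] by linarith
  qed
  have "f = h"
  proof (rule poly_eqI_degree)
    show "degree f < card (x ` S)" "degree h < card (x ` S)"
      using deg deg_h by (simp_all add: card_image inj)
    fix y assume "y \<in> x ` S"
    then obtain i where i: "i \<in> S" "y = x i" by auto
    have z: "poly (g l) (x i) = 0" if "l \<in> S - {i}" for l
      unfolding g_def poly_prod using fin i that by (intro prod_zero) auto
    have nz: "(\<Prod>l\<in>S - {i}. x i - x l) \<noteq> 0"
      using fin inj i by (auto simp: inj_on_def)
    have "poly h (x i) = c i * poly (g i) (x i) + (\<Sum>l\<in>S - {i}. c l * poly (g l) (x i))"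
      unfolding h_def using fin i by (simp add: poly_sum sum.remove)
    also have "(\<Sum>l\<in>S - {i}. c l * poly (g l) (x i)) = 0" using z by simp
    also have "poly (g i) (x i) = (\<Prod>l\<in>S - {i}. x i - x l)"
      by (simp add: g_def poly_prod)
    finally show "poly f y = poly h y" using nz i by (simp add: c_def)
  qed
  then have "poly f s = (\<Sum>i\<in>S. c i * (\<Prod>l\<in>S - {i}. s - x l))"
    by (simp add: h_def g_def poly_sum poly_prod)
  then have "poly f s / (\<Prod>i\<in>S. s - x i) =
      (\<Sum>i\<in>S. c i * (\<Prod>l\<in>S - {i}. s - x l) / (\<Prod>i\<in>S. s - x i))"
    by (simp add: sum_divide_distrib)
  also have "\<dots> = (\<Sum>i\<in>S. c i / (s - x i))"
  proof (rule sum.cong[OF refl])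
    fix i assume i: "i \<in> S"
    have "(\<Prod>l\<in>S. s - x l) = (s - x i) * (\<Prod>l\<in>S - {i}. s - x l)"
      using fin i by (rule prod.remove)
    moreover have "(\<Prod>l\<in>S - {i}. s - x l) \<noteq> 0" using fin s by auto
    ultimately show "c i * (\<Prod>l\<in>S - {i}. s - x l) / (\<Prod>l\<in>S. s - x l) = c i / (s - x i)"
      by simp
  qed
  finally show ?thesis by (simp add: c_def)
qed

text \<open>
  Partial fractions of \<open>\<Prod>\<^sub>i (t + a\<^sub>i) / ((t + y) \<Prod>\<^sub>j (t + b\<^sub>j))\<close>, solved for the term with the pole \<open>- y\<close>.
\<close>

lemma inverse_linear_telescope_step:
  fixes a :: "'b \<Rightarrow> 'a::field" and b :: "'c \<Rightarrow> 'a"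
  assumes fin: "finite P" "finite Q" and card: "card P \<le> card Q"
    and inj: "inj_on b Q" and y: "y \<notin> b ` Q" "t + y \<noteq> 0"
    and a: "\<And>i. i \<in> P \<Longrightarrow> a i \<noteq> y" and t: "\<And>j. j \<in> Q \<Longrightarrow> t + b j \<noteq> 0"
  shows "1 / (t + y) =
    (\<Prod>i\<in>P. t + a i) * (\<Prod>j\<in>Q. b j - y) / ((\<Prod>j\<in>Q. t + b j) * (\<Prod>i\<in>P. a i - y)) / (t + y) +
    (\<Sum>j\<in>Q. (\<Prod>i\<in>P. (a i - b j) / (a i - y)) * (\<Prod>i\<in>Q - {j}. (b i - y) / (b i - b j)) / (t + b j))"
proof -
  define f where "f = (\<Prod>i\<in>P. [:a i, 1:])"
  \<comment> \<open>The index \<open>None\<close> stands for the pole \<open>- y\<close> and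
    \<open>Some j\<close> for the pole \<open>- b j\<close>. The extra pole makes the degree of the
    numerator, at most \<open>card P\<close>, smaller than the number of poles.\<close>
  define x where "x = (\<lambda>u. case u of None \<Rightarrow> - y | Some j \<Rightarrow> - b j)"
  define S where "S = insert None (Some ` Q)"
  define A where "A = (\<Prod>i\<in>P. a i - y)"
  define B where "B = (\<Prod>j\<in>Q. b j - y)"
  have nz: "A \<noteq> 0" "B \<noteq> 0" "(\<Prod>j\<in>Q. t + b j) \<noteq> 0"
    using fin a t y by (auto simp: A_def B_def)
  have f: "poly f u = (\<Prod>i\<in>P. u + a i)" for u
    by (simp add: f_def poly_prod add.commute)
  have "degree f \<le> (\<Sum>i\<in>P. degree [:a i, 1:])"
    unfolding f_def using degree_prod_sum_le[OF fin(1), of "\<lambda>i. [:a i, 1:]"] by (simp add: o_def)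
  also have "\<dots> < card S"
    using fin card by (simp add: S_def card_image)
  finally have deg: "degree f < card S" .
  have injx: "inj_on x S"
    using inj y by (auto simp: inj_on_def S_def x_def split: option.splits)
  have S1: "S - {None} = Some ` Q" by (auto simp: S_def)
  have S2: "S - {Some j} = insert None (Some ` (Q - {j}))" for j by (auto simp: S_def)
  have sx: "t \<noteq> x u" if "u \<in> S" for u
    using that y t by (auto simp: S_def x_def eq_neg_iff_add_eq_0 split: option.splits)
  have "poly f t / (\<Prod>i\<in>S. t - x i) =
      (\<Sum>i\<in>S. poly f (x i) / (\<Prod>l\<in>S - {i}. x i - x l) / (t - x i))"
    using fin injx deg sx by (intro partial_fraction_expansion) (auto simp: S_def)
  also have "\<dots> = poly f (- y) / B / (t + y) +
      (\<Sum>j\<in>Q. poly f (- b j) / ((y - b j) * (\<Prod>i\<in>Q - {j}. b i - b j)) / (t + b j))"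
    unfolding B_def using fin
    by (subst (1) S_def, subst sum.insert)
       (auto simp: S1 S2 x_def sum.reindex prod.reindex)
  also have "(\<Prod>i\<in>S. t - x i) = (t + y) * (\<Prod>j\<in>Q. t + b j)"
    using fin by (simp add: S_def x_def prod.reindex)
  finally have eq: "poly f t / ((t + y) * (\<Prod>j\<in>Q. t + b j)) = A / B / (t + y) +
      (\<Sum>j\<in>Q. poly f (- b j) / ((y - b j) * (\<Prod>i\<in>Q - {j}. b i - b j)) / (t + b j))"
    by (simp add: f A_def)
  \<comment> \<open>\<open>A / B\<close> is the residue at \<open>- y\<close>; multiplying by its
    inverse normalizes that term to \<open>1 / (t + y)\<close>.\<close>
  have cancel: "A / B / (t + y) * (B / A) = 1 / (t + y)"
    using nz by simp
  have 1: "1 / (t + y) = poly f t / ((t + y) * (\<Prod>j\<in>Q. t + b j)) * (B / A) -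
      (\<Sum>j\<in>Q. poly f (- b j) / ((y - b j) * (\<Prod>i\<in>Q - {j}. b i - b j)) / (t + b j)) * (B / A)"
    unfolding eq unfolding distrib_right cancel by simp
  \<comment> \<open>The factor \<open>y - b j\<close> cancels against the factor
    \<open>b j - y\<close> of \<open>B\<close> and leaves a minus sign, which compensates the one
    from moving the sum to the other side.\<close>
  have 2: "poly f (- b j) / ((y - b j) * (\<Prod>i\<in>Q - {j}. b i - b j)) / (t + b j) * (B / A) =
     - ((\<Prod>i\<in>P. (a i - b j) / (a i - y)) * (\<Prod>i\<in>Q - {j}. (b i - y) / (b i - b j)) / (t + b j))"
    if j: "j \<in> Q" for j
  proof -
    have B: "B = (b j - y) * (\<Prod>i\<in>Q - {j}. b i - y)"
      unfolding B_def using fin j by (intro prod.remove)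
    have yj: "y - b j \<noteq> 0" using y j by auto
    have "B / (y - b j) = - (\<Prod>i\<in>Q - {j}. b i - y)"
      unfolding B using yj by (simp add: field_simps)
    moreover have regroup: "c / (d * e) / g * (B / A) = c / e / g * (B / d / A)" for c d e g
      by (simp add: mult_ac)
    ultimately have "poly f (- b j) / ((y - b j) * (\<Prod>i\<in>Q - {j}. b i - b j)) / (t + b j) * (B / A) =
        poly f (- b j) / (\<Prod>i\<in>Q - {j}. b i - b j) / (t + b j) * (- (\<Prod>i\<in>Q - {j}. b i - y) / A)"
      by (simp only: regroup)
    then show ?thesis
      by (simp add: f A_def prod_dividef add.commute mult_ac)
  qed
  have 3: "(\<Sum>j\<in>Q. poly f (- b j) / ((y - b j) * (\<Prod>i\<in>Q - {j}. b i - b j)) / (t + b j)) * (B / A) =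
     - (\<Sum>j\<in>Q. (\<Prod>i\<in>P. (a i - b j) / (a i - y)) * (\<Prod>i\<in>Q - {j}. (b i - y) / (b i - b j)) / (t + b j))"
    unfolding sum_distrib_right by (simp only: 2 sum_negf cong: sum.cong)
  show ?thesis
    using 1[unfolded 3] by (simp add: f A_def[symmetric] B_def[symmetric] mult_ac)
qed

section \<open>Products over the poles and the index bound\<close>

text \<open>The factors with \<open>l < K\<close> contribute \<open>(-1) ^ K * fact K\<close>, those
  with \<open>l > K\<close> the other factorial. This is the origin of the sign and the factorials
  in \<open>coeffP\<close>.\<close>

lemma prod_diff_nodes:
  assumes "K < m"
  shows "(\<Prod>l\<in>{..<m} - {K}. real l - real K) = (-1) ^ K * fact K * fact (m - K - 1)"
  using assms
proof (induction m)
  case (Suc m)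
  show ?case
  proof (cases "K = m")
    case True
    have "(\<Prod>l\<in>{..<Suc m} - {K}. real l - real K) = pochhammer (- real m) m"
      unfolding pochhammer_prod using True by (intro prod.cong) auto
    then show ?thesis using True by (simp add: pochhammer_same)
  next
    case False
    then have K: "K < m" using Suc by simp
    have "{..<Suc m} - {K} = insert m ({..<m} - {K})" using K by auto
    moreover have "Suc m - K - 1 = Suc (m - K - 1)" using K by simp
    moreover have "real m - real K = real (Suc (m - K - 1))" using K by simp
    ultimately show ?thesis using Suc.IH[OF K]
      by (simp add: algebra_simps)
  qed
qed simp

lemma prod_pochhammer_Sigma:
  assumes "finite I"
  shows "(\<Prod>i\<in>I. pochhammer (c i) (n i)) =
    (\<Prod>(i, l)\<in>(SIGMA i:I. {..<n i}). c i + of_nat l)"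
  using assms by (simp add: pochhammer_prod atLeast0LessThan prod.Sigma)

text \<open>Near-diagonality enters here: the expansion of \<open>1 / (s + b J + K)\<close> uses
  only indices \<open>k < K + kdelta j J\<close>, and these must not exceed the degree
  \<open>n j - 1\<close> available to \<open>A j\<close>.\<close>

lemma near_diagonal_index_bound:
  assumes "near_diagonal q n" "j \<in> {1..q}" "J \<in> {1..q}" "K < n J"
  shows "K + kdelta j J \<le> n j"
proof -
  have "\<bar>int (n j) - int (n J)\<bar> \<le> 1" using assms by (simp add: near_diagonal_def)
  then show ?thesis using assms(4) by (auto simp: kdelta_def)
qed

section \<open>Separated parameters and the expansion of a simple fraction\<close>

text \<open>The separation assumptions are put in the form in which poles are compared. Equality of
  \<open>a i\<close> and \<open>b j\<close> remains possible for different indices, hence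
  \<open>m \<ge> 1\<close>.\<close>

locale mixed_parameters =
  fixes p q :: nat and a b :: "nat \<Rightarrow> real"
  assumes p_less_q: "p < q"
    and a_gt: "i \<in> {1..p} \<Longrightarrow> a i > -1"
    and b_gt: "j \<in> {1..q} \<Longrightarrow> b j > -1"
    and a_less_b: "j \<in> {1..p} \<Longrightarrow> a j < b j"
    and a_b_separated: "i \<in> {1..p} \<Longrightarrow> j \<in> {1..q} \<Longrightarrow> m \<ge> 1 \<Longrightarrow> a i \<noteq> b j + real m"
    and b_separated: "i \<in> {1..q} \<Longrightarrow> j \<in> {1..q} \<Longrightarrow> i \<noteq> j \<Longrightarrow> b i - b j \<notin> \<int>"
begin

text \<open>Guarantees that the points \<open>- b j - k\<close> belonging to different pairs are
  different, so that all poles below are simple.\<close>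

lemma b_shift_eq_iff:
  assumes "i \<in> {1..q}" "j \<in> {1..q}"
  shows "b i + real k = b j + real l \<longleftrightarrow> i = j \<and> k = l"
proof
  assume eq: "b i + real k = b j + real l"
  then have "b i - b j = of_int (int l - int k)" by simp
  then have "b i - b j \<in> \<int>" by (metis Ints_of_int)
  then have "i = j" using b_separated assms by blast
  then show "i = j \<and> k = l" using eq by simp
qed simp

lemma inj_on_b: "inj_on b {1..q}"
  using b_shift_eq_iff[of _ _ 0 0] by (auto simp: inj_on_def)

lemma shift_b_pos: "j \<in> {1..q} \<Longrightarrow> s \<ge> 1 \<Longrightarrow> s + b j > 0"
  using b_gt[of j] by simp

lemma pochhammer_b_pos: "j \<in> {1..q} \<Longrightarrow> s \<ge> 1 \<Longrightarrow> pochhammer (s + b j) k > 0"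
  by (intro pochhammer_pos shift_b_pos)

text \<open>The factors are \<open>a i - b j - (K - l)\<close> with \<open>l < k\<close>, so the
  shift \<open>K - l\<close> is at least 1. The factor \<open>a i - b j\<close>, which may vanish,
  would first occur at length \<open>K + 1\<close>.\<close>

lemma pochhammer_a_nonzero:
  assumes "i \<in> {1..p}" "j \<in> {1..q}" "k \<le> K"
  shows "pochhammer (a i - b j - real K) k \<noteq> 0"
proof
  assume "pochhammer (a i - b j - real K) k = 0"
  then obtain l where l: "l < k" "a i - b j - real K = - real l"
    by (auto simp: pochhammer_eq_0_iff)
  have "a i = b j + real (K - l)"
    using l assms by (simp add: of_nat_diff)
  moreover have "K - l \<ge> 1" using l assms by linarith
  ultimately show False
    using a_b_separated assms by blast
qed

text \<open>Up to the common factor \<Gamma>(s + a) / \<Gamma>(s + b), this is the moment of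
  \<open>z ^ k\<close> times the \<open>j\<close>-th weight with exponent \<open>s - 1\<close>; the
  last factor of the denominator comes from the unit vector in the weight.\<close>

definition ratio_fn :: "nat \<Rightarrow> nat \<Rightarrow> real \<Rightarrow> real" where
  "ratio_fn j k s = (\<Prod>i=1..p. pochhammer (s + a i) k) /
     ((\<Prod>i=1..q. pochhammer (s + b i) k) * (s + b j + real k))"

text \<open>The coefficient of \<open>ratio_fn j k\<close> in the expansion of
  \<open>1 / (s + b J + K)\<close>. The prefactor of the final formula is included: its numerator in
  \<open>a_quot\<close>, its denominator in the last division.\<close>

definition expansion_coeff :: "nat \<Rightarrow> nat \<Rightarrow> nat \<Rightarrow> nat \<Rightarrow> real" where
  "expansion_coeff j J K k =
     a_quot p a b j J K k * vpoch ({1..q} - {j}) (\<lambda>i. b i - b J - real K) (k + 1) *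
     pochhammer (b j - b J - real K) k / vpoch ({1..q} - {j}) (\<lambda>i. b i - b j) 1"

text \<open>Each step applies the partial fraction identity at \<open>t = s + m\<close> and
  \<open>y = b J + K - m\<close>, multiplied by \<open>T m\<close>. Since \<open>t + y\<close> does
  not depend on \<open>m\<close>, the first term becomes the next remainder and the sum is the
  contribution of level \<open>m\<close>.\<close>

lemma inverse_linear_telescope:
  assumes J: "J \<in> {1..q}" and s: "s \<ge> 1" and m: "m \<le> K"
  defines "T \<equiv> (\<lambda>k. (\<Prod>i=1..p. pochhammer (s + a i) k / pochhammer (a i - b J - real K) k) *
       (\<Prod>i=1..q. pochhammer (b i - b J - real K) k / pochhammer (s + b i) k))"
  shows "1 / (s + b J + real K) = T m / (s + b J + real K) +
    (\<Sum>k<m. \<Sum>j=1..q. expansion_coeff j J K k * ratio_fn j k s)"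
  using m
proof (induction m)
  case 0
  then show ?case by (simp add: T_def)
next
  case (Suc m)
  define x where "x = b J + real K"
  define y where "y = x - real m"
  define t where "t = s + real m"
  have y_alt: "y = b J + real (K - m)" using Suc.prems by (simp add: y_def x_def)
  have ty: "t + y = s + x" by (simp add: t_def y_def)
  have xK: "c - b J - real K = c - x" for c by (simp add: x_def)
  have poch_t: "pochhammer (s + c) (Suc m) = pochhammer (s + c) m * (t + c)" for c
    by (simp add: pochhammer_Suc t_def)
  have poch_y: "pochhammer (c - x) (Suc m) = pochhammer (c - x) m * (c - y)" for c
    by (simp add: pochhammer_Suc y_def)
  \<comment> \<open>In the induction step \<open>m < K\<close>, so the shift \<open>K - m\<close> is
    positive and \<open>y\<close> is none of the \<open>b i\<close>, including \<open>b J\<close>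
    itself.\<close>
  have y_b: "y \<notin> b ` {1..q}"
  proof
    assume "y \<in> b ` {1..q}"
    then obtain i where "i \<in> {1..q}" "b J + real (K - m) = b i + real 0"
      by (auto simp: y_alt)
    then have "K - m = 0" using b_shift_eq_iff[OF J] by blast
    then show False using Suc.prems by simp
  qed
  have sx: "s + x > 0" using shift_b_pos[OF J s] by (simp add: x_def)
  have "1 / (t + y) =
    (\<Prod>i=1..p. t + a i) * (\<Prod>j=1..q. b j - y) / ((\<Prod>j=1..q. t + b j) * (\<Prod>i=1..p. a i - y)) / (t + y) +
    (\<Sum>j=1..q. (\<Prod>i=1..p. (a i - b j) / (a i - y)) *
       (\<Prod>i\<in>{1..q} - {j}. (b i - y) / (b i - b j)) / (t + b j))"
  proof (rule inverse_linear_telescope_step)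
    show "card {1..p} \<le> card {1..q}" using p_less_q by simp
    show "t + y \<noteq> 0" using sx ty by simp
    show "a i \<noteq> y" if "i \<in> {1..p}" for i
      using a_b_separated[OF that J, of "K - m"] Suc.prems by (auto simp: y_alt)
    show "t + b j \<noteq> 0" if "j \<in> {1..q}" for j
      using shift_b_pos[OF that s] by (simp add: t_def)
  qed (use inj_on_b y_b in auto)
  then have e1: "T m * (1 / (t + y)) = T m *
    ((\<Prod>i=1..p. t + a i) * (\<Prod>j=1..q. b j - y) / ((\<Prod>j=1..q. t + b j) * (\<Prod>i=1..p. a i - y)) / (t + y)) +
    (\<Sum>j=1..q. T m * ((\<Prod>i=1..p. (a i - b j) / (a i - y)) *
       (\<Prod>i\<in>{1..q} - {j}. (b i - y) / (b i - b j)) / (t + b j)))"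
    by (simp only: distrib_left sum_distrib_left)
  have e2: "T m * ((\<Prod>i=1..p. t + a i) * (\<Prod>j=1..q. b j - y) /
      ((\<Prod>j=1..q. t + b j) * (\<Prod>i=1..p. a i - y)) / (t + y)) = T (Suc m) / (t + y)"
  proof -
    have "T (Suc m) = T m * ((\<Prod>i=1..p. t + a i) * (\<Prod>j=1..q. b j - y) /
      ((\<Prod>j=1..q. t + b j) * (\<Prod>i=1..p. a i - y)))"
      unfolding T_def xK
      by (simp add: poch_t poch_y prod.distrib prod_dividef mult_ac)
    then show ?thesis by simp
  qed
  have e3: "T m * ((\<Prod>i=1..p. (a i - b j) / (a i - y)) *
       (\<Prod>i\<in>{1..q} - {j}. (b i - y) / (b i - b j)) / (t + b j)) =
      expansion_coeff j J K m * ratio_fn j m s" if j: "j \<in> {1..q}" for j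
  proof -
    \<comment> \<open>Because \<open>m < K\<close>, the cancelled branch of \<open>a_quot\<close>
      does not occur.\<close>
    have aq: "a_quot p a b j J K m =
        (\<Prod>i=1..p. (a i - b j) / (pochhammer (a i - x) m * (a i - y)))"
      unfolding a_quot_def xK using Suc.prems
      by (intro prod.cong) (auto simp: poch_y)
    have bq: "vpoch ({1..q} - {j}) (\<lambda>i. b i - b J - real K) (m + 1) =
        (\<Prod>i\<in>{1..q} - {j}. pochhammer (b i - x) m) * (\<Prod>i\<in>{1..q} - {j}. b i - y)"
      unfolding vpoch_def xK
      by (simp add: poch_y prod.distrib)
    have br: "(\<Prod>i=1..q. pochhammer (b i - x) m) =
        pochhammer (b j - x) m * (\<Prod>i\<in>{1..q} - {j}. pochhammer (b i - x) m)"
      using j by (intro prod.remove) auto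
    have tb: "s + b j + real m = t + b j" by (simp add: t_def)
    show ?thesis
      unfolding expansion_coeff_def ratio_fn_def aq bq tb
      unfolding T_def xK prod.distrib prod_dividef br
      by (simp add: vpoch_def mult_ac)
  qed
  have step: "T m * (1 / (t + y)) = T (Suc m) / (t + y) +
      (\<Sum>j=1..q. expansion_coeff j J K m * ratio_fn j m s)"
    unfolding e1 e2 by (simp only: e3 cong: sum.cong)
  have tyJ: "t + y = s + b J + real K" unfolding ty x_def by simp
  show ?case
    using Suc.IH[OF Suc_leD[OF Suc.prems]] step[unfolded tyJ times_divide_eq_right mult_1_right]
    unfolding sum.lessThan_Suc by linarith
qed

text \<open>Telescoping stops after \<open>K\<close> steps, since a further step would divide by
  \<open>a i - b J\<close>, possibly zero. The remainder is already the term with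
  \<open>j = J\<close> and \<open>k = K\<close>, which accounts for \<open>kdelta j J\<close> in the
  upper limit.\<close>

lemma inverse_linear_expansion:
  assumes J: "J \<in> {1..q}" and s: "s \<ge> 1"
  shows "1 / (s + b J + real K) =
    (\<Sum>j=1..q. \<Sum>k<K + kdelta j J. expansion_coeff j J K k * ratio_fn j k s)"
proof -
  define x where "x = b J + real K"
  have xK: "c - b J - real K = c - x" for c by (simp add: x_def)
  have poch: "pochhammer (c - x) (Suc K) = pochhammer (c - x) K * (c - b J)" for c
    by (simp add: pochhammer_Suc x_def)
  define g where "g j k = expansion_coeff j J K k * ratio_fn j k s" for j k
  have "expansion_coeff J J K K =
      (\<Prod>i=1..p. 1 / pochhammer (a i - x) K) * (\<Prod>i=1..q. pochhammer (b i - x) K)"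
  proof -
    \<comment> \<open>Both branches agree here: if \<open>a i = b J\<close> this is the definition,
      and otherwise the nonzero factor \<open>a i - b J\<close> cancels.\<close>
    have "a_quot p a b J J K K = (\<Prod>i=1..p. 1 / pochhammer (a i - x) K)"
      unfolding a_quot_def xK
      by (intro prod.cong) (auto simp: poch)
    moreover have "vpoch ({1..q} - {J}) (\<lambda>i. b i - b J - real K) (K + 1) =
        (\<Prod>i\<in>{1..q} - {J}. pochhammer (b i - x) K) * vpoch ({1..q} - {J}) (\<lambda>i. b i - b J) 1"
      unfolding vpoch_def xK by (simp add: poch prod.distrib)
    moreover have "vpoch ({1..q} - {J}) (\<lambda>i. b i - b J) 1 \<noteq> 0"
    proof -
      have "b i \<noteq> b J" if "i \<in> {1..q} - {J}" for i
        using b_shift_eq_iff[of i J 0 0] that J by simp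
      then show ?thesis by (simp add: vpoch_def)
    qed
    moreover have "(\<Prod>i=1..q. pochhammer (b i - x) K) =
        pochhammer (b J - x) K * (\<Prod>i\<in>{1..q} - {J}. pochhammer (b i - x) K)"
      using J by (intro prod.remove) auto
    ultimately show ?thesis unfolding expansion_coeff_def xK by (simp add: mult_ac)
  qed
  then have last: "g J K = (\<Prod>i=1..p. pochhammer (s + a i) K / pochhammer (a i - x) K) *
       (\<Prod>i=1..q. pochhammer (b i - x) K / pochhammer (s + b i) K) / (s + b J + real K)"
    unfolding g_def ratio_fn_def by (simp add: prod_dividef mult_ac)
  have "(\<Sum>j=1..q. \<Sum>k<K + kdelta j J. g j k) =
      (\<Sum>j=1..q. (\<Sum>k<K. g j k) + (if j = J then g J K else 0))"
    by (intro sum.cong) (auto simp: kdelta_def)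
  also have "\<dots> = (\<Sum>j=1..q. \<Sum>k<K. g j k) + g J K"
    using J by (simp add: sum.distrib)
  also have "(\<Sum>j=1..q. \<Sum>k<K. g j k) = (\<Sum>k<K. \<Sum>j=1..q. g j k)"
    by (rule sum.swap)
  finally show ?thesis
    using inverse_linear_telescope[OF J s order_refl, of K] unfolding g_def[symmetric] xK last
    by linarith
qed

section \<open>Residues of the normalized moments\<close>

text \<open>There are \<open>msize q n\<close> simple poles and the numerator has smaller degree, so
  no polynomial part arises; the residue at \<open>- b J - K\<close> evaluates to
  \<open>coeffP\<close>.\<close>

lemma moment_partial_fractions:
  assumes N: "msize q n \<ge> 1" and s: "s \<ge> 1"
  shows "pochhammer (1 - s) (msize q n - 1) / (\<Prod>i=1..q. pochhammer (s + b i) (n i)) =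
    (\<Sum>J=1..q. \<Sum>K<n J. coeffP q b n J K / (s + b J + real K))"
proof -
  define S where "S = (SIGMA J:{1..q}. {..<n J})"
  define x where "x = (\<lambda>(J, K). - b J - real K)"
  define f where "f = (\<Prod>l<msize q n - 1. [:1 + real l, -1:])"
  have f: "poly f u = pochhammer (1 - u) (msize q n - 1)" for u
    by (simp add: f_def poly_prod pochhammer_prod atLeast0LessThan algebra_simps)
  have "degree f \<le> (\<Sum>l<msize q n - 1. degree [:1 + real l, -1:])"
    unfolding f_def using degree_prod_sum_le[of "{..<msize q n - 1}" "\<lambda>l. [:1 + real l, -1:]"]
    by (simp add: o_def)
  also have "\<dots> < card S" using N by (simp add: S_def msize_def)
  finally have deg: "degree f < card S" .
  have inj: "inj_on x S"
  proof (rule inj_onI, clarify)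
    fix i k j l assume "(i, k) \<in> S" "(j, l) \<in> S" "x (i, k) = x (j, l)"
    then show "i = j \<and> k = l"
      using b_shift_eq_iff[of i j k l] by (auto simp: S_def x_def)
  qed
  have sx: "s \<noteq> x u" if "u \<in> S" for u
  proof (cases u)
    case (Pair J K)
    then show ?thesis using that shift_b_pos[of J s] s by (auto simp: S_def x_def)
  qed
  have pf: "poly f s / (\<Prod>u\<in>S. s - x u) =
      (\<Sum>u\<in>S. poly f (x u) / (\<Prod>v\<in>S - {u}. x u - x v) / (s - x u))"
    using inj deg sx by (intro partial_fraction_expansion) (auto simp: S_def)
  have den_all: "(\<Prod>u\<in>S. s - x u) = (\<Prod>i=1..q. pochhammer (s + b i) (n i))"
    by (auto simp: S_def prod_pochhammer_Sigma x_def algebra_simps intro!: prod.cong)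
  have "poly f (x (J, K)) / (\<Prod>v\<in>S - {(J, K)}. x (J, K) - x v) = coeffP q b n J K"
    if JK: "(J, K) \<in> S" for J K
  proof -
    have J: "J \<in> {1..q}" and K: "K < n J" using JK by (auto simp: S_def)
    \<comment> \<open>Poles attached to another \<open>b i\<close> yield the Pochhammer symbols in
      \<open>coeffP\<close>, those attached to the same \<open>b J\<close> the factorials.\<close>
    have split: "S - {(J, K)} =
        (SIGMA i:{1..q} - {J}. {..<n i}) \<union> Pair J ` ({..<n J} - {K})"
      using J K by (auto simp: S_def)
    have "(\<Prod>v\<in>S - {(J, K)}. x (J, K) - x v) =
        (\<Prod>v\<in>(SIGMA i:{1..q} - {J}. {..<n i}). x (J, K) - x v) *
        (\<Prod>v\<in>Pair J ` ({..<n J} - {K}). x (J, K) - x v)"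
      unfolding split by (intro prod.union_disjoint) auto
    also have "(\<Prod>v\<in>(SIGMA i:{1..q} - {J}. {..<n i}). x (J, K) - x v) =
        (\<Prod>i\<in>{1..q} - {J}. pochhammer (b i - b J - real K) (n i))"
      by (auto simp: prod_pochhammer_Sigma x_def algebra_simps intro!: prod.cong)
    also have "(\<Prod>v\<in>Pair J ` ({..<n J} - {K}). x (J, K) - x v) =
        (\<Prod>l\<in>{..<n J} - {K}. real l - real K)"
      by (subst prod.reindex) (auto simp: x_def inj_on_def)
    also have "\<dots> = (-1) ^ K * fact K * fact (n J - K - 1)"
      by (rule prod_diff_nodes[OF K])
    finally have den: "(\<Prod>v\<in>S - {(J, K)}. x (J, K) - x v) =
        (\<Prod>i\<in>{1..q} - {J}. pochhammer (b i - b J - real K) (n i)) *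
        ((-1) ^ K * fact K * fact (n J - K - 1))" .
    have num: "1 - x (J, K) = b J + real K + 1" by (simp add: x_def)
    have sign: "c / (d * ((-1) ^ K * e * g)) = c / d * ((-1) ^ K / (e * g))" for c d e g :: real
      by (cases "even K") auto
    show ?thesis
      unfolding f num den sign coeffP_def ..
  qed
  then have coeff: "poly f (x u) / (\<Prod>v\<in>S - {u}. x u - x v) / (s - x u) =
      (case u of (J, K) \<Rightarrow> coeffP q b n J K / (s - x (J, K)))" if "u \<in> S" for u
    using that by (cases u) simp
  have "pochhammer (1 - s) (msize q n - 1) / (\<Prod>i=1..q. pochhammer (s + b i) (n i)) =
      (\<Sum>u\<in>S. case u of (J, K) \<Rightarrow> coeffP q b n J K / (s - x (J, K)))"
    using pf sum.cong[OF refl coeff] unfolding f den_all by simp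
  also have "\<dots> = (\<Sum>J=1..q. \<Sum>K<n J. coeffP q b n J K / (s - x (J, K)))"
    unfolding S_def by (rule sum.Sigma[symmetric]) auto
  finally show ?thesis by (simp add: x_def algebra_simps)
qed

text \<open>
  Clearing denominators makes the relation a polynomial identity, which is evaluated at \<open>- b\<^sub>j - k\<close> by
  descending induction on \<open>k\<close>.
\<close>

lemma ratio_fn_independent:
  assumes zero: "\<And>s::nat. s \<ge> 1 \<Longrightarrow> (\<Sum>j=1..q. \<Sum>k<n j. c j k * ratio_fn j k (real s)) = 0"
    and j: "j \<in> {1..q}" and k: "k < n j"
  shows "c j k = 0"
proof -
  define M where "M = msize q n"
  have nM: "n i \<le> M" if "i \<in> {1..q}" for i
    unfolding M_def msize_def using that by (intro member_le_sum) auto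
  \<comment> \<open>The common denominator \<open>D\<close> has the factors
    \<open>s + b i + l\<close> with \<open>l < M\<close>. The denominator of
    \<open>ratio_fn j k\<close> removes those with \<open>l < k\<close> and the one at
    \<open>(j, k)\<close>; \<open>R j k\<close> indexes what is left.\<close>
  define R where "R j k = {1..q} \<times> {k..<M} - {(j, k)}" for j k
  define Q where "Q j k =
     (\<Prod>i=1..p. \<Prod>l<k. [:a i + real l, 1:]) * (\<Prod>(i, l)\<in>R j k. [:b i + real l, 1:])" for j k
  define D where "D s = (\<Prod>i=1..q. pochhammer (s + b i) M)" for s
  define H where "H = (\<Sum>j=1..q. \<Sum>k<n j. smult (c j k) (Q j k))"
  have Q: "poly (Q j k) u =
      (\<Prod>i=1..p. pochhammer (u + a i) k) * (\<Prod>(i, l)\<in>R j k. u + b i + real l)" for j k u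
    by (simp add: Q_def poly_prod pochhammer_prod atLeast0LessThan case_prod_unfold algebra_simps)
  have Q_ratio: "poly (Q j k) s = ratio_fn j k s * D s"
    if j: "j \<in> {1..q}" and k: "k < n j" and s: "s \<ge> 1" for j k s
  proof -
    have k': "k < M" using nM[OF j] k by simp
    have "D s = (\<Prod>i=1..q. pochhammer (s + b i) k * pochhammer (s + b i + real k) (M - k))"
      unfolding D_def using k' by (simp add: pochhammer_product[of k M])
    also have "\<dots> = (\<Prod>i=1..q. pochhammer (s + b i) k) *
        (\<Prod>i=1..q. \<Prod>l=k..<M. s + b i + real l)"
    proof -
      have "pochhammer (s + b i + real k) (M - k) = (\<Prod>l=k..<M. s + b i + real l)" for i
        unfolding pochhammer_prod using k' prod.shift_bounds_nat_ivl[of "\<lambda>l. s + b i + real l" 0 k "M - k"]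
        by (simp add: algebra_simps)
      then show ?thesis by (simp add: prod.distrib)
    qed
    also have "(\<Prod>i=1..q. \<Prod>l=k..<M. s + b i + real l) =
        (\<Prod>(i, l)\<in>{1..q} \<times> {k..<M}. s + b i + real l)"
      by (rule prod.cartesian_product)
    also have "\<dots> = (s + b j + real k) * (\<Prod>(i, l)\<in>R j k. s + b i + real l)"
      unfolding R_def using j k' by (subst prod.remove[of _ "(j, k)"]) auto
    finally have "D s = (\<Prod>i=1..q. pochhammer (s + b i) k) *
        ((s + b j + real k) * (\<Prod>(i, l)\<in>R j k. s + b i + real l))" .
    moreover have "(\<Prod>i=1..q. pochhammer (s + b i) k) \<noteq> 0"
      using pochhammer_b_pos[OF _ s, of _ k] by (simp add: less_le)
    moreover have "s + b j + real k \<noteq> 0" using shift_b_pos[OF j s] by simp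
    ultimately show ?thesis by (simp add: Q ratio_fn_def)
  qed
  \<comment> \<open>\<open>H\<close> vanishes at every positive integer, hence identically, which
    allows evaluation at the poles themselves.\<close>
  have H0: "H = 0"
  proof (rule ccontr)
    assume "H \<noteq> 0"
    then have "finite {u. poly H u = 0}" by (rule poly_roots_finite)
    moreover have "real ` {1..} \<subseteq> {u. poly H u = 0}"
    proof safe
      fix s :: nat assume s: "s \<ge> 1"
      have "poly H (real s) = (\<Sum>j=1..q. \<Sum>k<n j. c j k * ratio_fn j k (real s)) * D (real s)"
        using s by (simp add: H_def poly_sum Q_ratio sum_distrib_right mult.assoc)
      then show "poly H (real s) = 0" using zero[OF s] by simp
    qed
    moreover have "infinite (real ` {1::nat..})"
      using infinite_Ici[of "1::nat"] by (simp add: finite_image_iff)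
    ultimately show False using finite_subset by blast
  qed
  show ?thesis
    using j k
  proof (induction "M - k" arbitrary: j k rule: less_induct)
    case (less k j)
    define u where "u = - b j - real k"
    have kM: "k < M" using nM less.prems by force
    \<comment> \<open>For larger \<open>k'\<close> the coefficient vanishes by induction. For
      \<open>k' \<le> k\<close> the factor of the pole \<open>(j, k)\<close> has survived in
      \<open>Q j' k'\<close> and is zero at \<open>u\<close>.\<close>
    have other: "c j' k' * poly (Q j' k') u = 0"
      if "j' \<in> {1..q}" "k' < n j'" "(j', k') \<noteq> (j, k)" for j' k'
    proof (cases "k' > k")
      case True
      then show ?thesis using less.hyps[of k' j'] that kM by simp
    next
      case False
      then have "(j, k) \<in> R j' k'" using that less.prems kM by (auto simp: R_def)
      moreover have "finite (R j' k')" by (simp add: R_def)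
      ultimately have "(\<Prod>(i, l)\<in>R j' k'. u + b i + real l) = 0"
        by (intro prod_zero) (auto simp: u_def intro!: bexI[of _ "(j, k)"])
      then show ?thesis by (simp add: Q)
    qed
    define W where "W = (SIGMA j':{1..q}. {..<n j'})"
    have W: "finite W" "(j, k) \<in> W" using less.prems by (simp_all add: W_def)
    have "0 = poly H u" using H0 by simp
    also have "poly H u = (\<Sum>(j', k')\<in>W. c j' k' * poly (Q j' k') u)"
      unfolding H_def W_def poly_sum poly_smult by (rule sum.Sigma) simp_all
    also have "\<dots> = c j k * poly (Q j k) u + (\<Sum>(j', k')\<in>W - {(j, k)}. c j' k' * poly (Q j' k') u)"
      using sum.remove[OF W, of "\<lambda>(j', k'). c j' k' * poly (Q j' k') u"] by simp
    also have "(\<Sum>(j', k')\<in>W - {(j, k)}. c j' k' * poly (Q j' k') u) = 0"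
    proof (intro sum.neutral ballI)
      fix v assume v: "v \<in> W - {(j, k)}"
      obtain j' k' where "v = (j', k')" by (cases v)
      with v other[of j' k'] show "(case v of (j', k') \<Rightarrow> c j' k' * poly (Q j' k') u) = 0"
        by (simp add: W_def)
    qed
    finally have "c j k * poly (Q j k) u = 0" by simp
    \<comment> \<open>The remaining linear factors belong to other poles, and the numerator is
      nonzero at \<open>u\<close> by the separation of \<open>a\<close> from
      \<open>b\<close>.\<close>
    moreover have "poly (Q j k) u \<noteq> 0"
    proof -
      have "u + b i + real l \<noteq> 0" if "(i, l) \<in> R j k" for i l
        using b_shift_eq_iff[of i j l k] that less.prems by (auto simp: R_def u_def)
      moreover have "pochhammer (u + a i) k \<noteq> 0" if "i \<in> {1..p}" for i
      proof -
        have "u + a i = a i - b j - real k" by (simp add: u_def)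
        then show ?thesis using pochhammer_a_nonzero that less.prems(1) by (metis order_refl)
      qed
      moreover have "finite (R j k)" by (simp add: R_def)
      ultimately show ?thesis by (auto simp: Q)
    qed
    ultimately show ?case by simp
  qed
qed

end

section \<open>Contour integrals over the unit circle\<close>

lemma poly_map_poly_of_real_lessThan:
  assumes "degree f \<le> m - 1" "m = 0 \<longrightarrow> f = 0"
  shows "poly (map_poly complex_of_real f) z = (\<Sum>k<m. complex_of_real (coeff f k) * z ^ k)"
\<comment> \<open>For \<open>m = 0\<close> natural subtraction lets the degree bound admit
  constants, so this case rests on the second assumption.\<close>
proof (cases "m = 0")
  case False
  have "degree (map_poly complex_of_real f) = degree f" by (rule degree_map_poly) simp
  then have "poly (map_poly complex_of_real f) z = (\<Sum>k\<le>degree f. complex_of_real (coeff f k) * z ^ k)"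
    by (simp add: poly_altdef coeff_map_poly)
  also have "\<dots> = (\<Sum>k<m. complex_of_real (coeff f k) * z ^ k)"
    using assms False by (intro sum.mono_neutral_left) (auto simp: coeff_eq_0)
  finally show ?thesis .
qed (use assms in simp)

text \<open>Cauchy's formula for the \<open>k\<close>-th derivative of \<open>w ^ m\<close> at 0,
  which is \<open>fact k\<close> for \<open>m = k\<close> and 0 otherwise.\<close>

lemma has_contour_integral_monomial_circle:
  "((\<lambda>z. z ^ m * (c / z ^ (k + 1))) has_contour_integral
    (if m = k then 2 * of_real pi * \<i> * c else 0)) (circlepath 0 1)"
proof -
  have deriv: "(deriv ^^ k) (\<lambda>w::complex. w ^ m) 0 = (if m = k then fact k else 0)"
    using higher_deriv_power[of k 0 m 0] by (cases m k rule: linorder_cases) (auto simp: pochhammer_fact pochhammer_0_left)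
  have "((\<lambda>z::complex. z ^ m / (z - 0) ^ Suc k) has_contour_integral
      (2 * of_real pi * \<i> / fact k * (deriv ^^ k) (\<lambda>w. w ^ m) 0)) (circlepath 0 1)"
    using Cauchy_has_contour_integral_higher_derivative_circlepath[of 0 1 "\<lambda>w. w ^ m" 0 k]
    by (simp add: continuous_intros holomorphic_intros)
  from has_contour_integral_lmul[OF this, of c] show ?thesis
    by (auto simp: deriv mult_ac split: if_splits)
qed

text \<open>On the circle each term has norm \<open>norm (c k)\<close> up to modulus-one factors, so
  the M-test gives uniform convergence and the series is integrated term by term.\<close>

lemma has_contour_integral_Laurent_circle:
  fixes c :: "nat \<Rightarrow> complex"
  assumes sum: "summable (\<lambda>k. norm (c k))"
  shows "((\<lambda>z. z ^ m * (\<Sum>k. c k / z ^ (k + 1))) has_contour_integral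
    2 * of_real pi * \<i> * c m) (circlepath 0 1)"
proof -
  define g where "g k z = z ^ m * (c k / z ^ (k + 1))" for k and z :: complex
  have norm_g: "norm (g k z) = norm (c k)" if "z \<in> sphere 0 1" for k z
    using that by (simp add: g_def norm_mult norm_divide norm_power)
  have partial: "((\<lambda>z. \<Sum>k<N. g k z) has_contour_integral
      (\<Sum>k<N. if m = k then 2 * of_real pi * \<i> * c k else 0)) (circlepath 0 1)" for N
    unfolding g_def by (intro has_contour_integral_sum has_contour_integral_monomial_circle) simp
  have unif: "uniform_limit (sphere 0 1) (\<lambda>N z. \<Sum>k<N. g k z) (\<lambda>z. \<Sum>k. g k z) sequentially"
    by (rule Weierstrass_m_test[OF _ sum]) (simp add: norm_g)
  have integrable: "\<forall>\<^sub>F N in sequentially. (\<lambda>z. \<Sum>k<N. g k z) contour_integrable_on circlepath 0 1"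
    using partial by (intro always_eventually) (auto simp: contour_integrable_on_def)
  note lim = contour_integral_uniform_limit_circlepath[OF integrable unif]
  have "(\<lambda>N. contour_integral (circlepath 0 1) (\<lambda>z. \<Sum>k<N. g k z))
      \<longlonglongrightarrow> 2 * of_real pi * \<i> * c m"
  \<comment> \<open>Only the term \<open>k = m\<close> contributes, so the integrals of the partial
    sums are constant once \<open>N > m\<close>.\<close>
  proof (rule tendsto_eventually)
    show "\<forall>\<^sub>F N in sequentially.
        contour_integral (circlepath 0 1) (\<lambda>z. \<Sum>k<N. g k z) = 2 * of_real pi * \<i> * c m"
      using eventually_gt_at_top[of m]
      by eventually_elim (simp add: contour_integral_unique[OF partial])
  qed
  then have "contour_integral (circlepath 0 1) (\<lambda>z. \<Sum>k. g k z) = 2 * of_real pi * \<i> * c m"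
    using lim(2) by (intro LIMSEQ_unique) simp_all
  with lim(1) have "((\<lambda>z. \<Sum>k. g k z) has_contour_integral 2 * of_real pi * \<i> * c m) (circlepath 0 1)"
    by (metis has_contour_integral_integral sequentially_bot zero_less_one)
  then show ?thesis
  proof (rule has_contour_integral_eq)
    fix z :: complex assume "z \<in> path_image (circlepath 0 1)"
    then have z: "norm z = 1" by simp
    have "summable (\<lambda>k. c k / z ^ (k + 1))"
      by (rule summable_norm_cancel) (use sum z in \<open>simp add: norm_divide norm_mult norm_power\<close>)
    then show "(\<Sum>k. g k z) = z ^ m * (\<Sum>k. c k / z ^ (k + 1))"
      unfolding g_def by (rule suminf_mult)
  qed
qed

section \<open>Moments of the weights and of the type I form\<close>

context mixed_parameters
begin

definition weight_coeff :: "nat \<Rightarrow> nat \<Rightarrow> real" where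
  "weight_coeff j k = vGamma {1..p} (\<lambda>i. real k + a i + 1) /
     vGamma {1..q} (\<lambda>i. real k + b i + real (kdelta i j) + 1)"

text \<open>Ratio test: each of the \<open>p\<close> numerator factors is bounded by its partner in
  the denominator since \<open>a i < b i\<close>, and at least one further denominator factor
  remains because \<open>p < q\<close>. It is at least 2 once \<open>k \<ge> 2\<close>.\<close>

lemma summable_weight_coeff: "summable (\<lambda>k. norm (complex_of_real (weight_coeff j k)))"
proof -
  have "summable (weight_coeff j)"
  proof (rule summable_ratio_test[of "1/2" 2])
    fix k :: nat assume k: "k \<ge> 2"
    define u where "u i = real k + a i + 1" for i
    define v where "v i = real k + b i + real (kdelta i j) + 1" for i
    have u: "u i > 0" if "i \<in> {1..p}" for i using a_gt[OF that] by (simp add: u_def)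
    have v: "v i \<ge> 2" if "i \<in> {1..q}" for i using b_gt[OF that] k by (simp add: v_def)
    have v0: "v i > 0" if "i \<in> {1..q}" for i using v[OF that] by simp
    have uv: "u i \<le> v i" if "i \<in> {1..p}" for i using a_less_b[OF that] by (simp add: u_def v_def)
    have G: "Gamma (x + 1) = x * Gamma x" if "x > 0" for x :: real
      using that by (intro Gamma_plus1) auto
    have "vGamma {1..p} (\<lambda>i. real (Suc k) + a i + 1) = (\<Prod>i=1..p. u i * Gamma (u i))"
      unfolding vGamma_def using G[OF u]
      by (intro prod.cong refl) (simp add: u_def add_ac)
    moreover have "vGamma {1..q} (\<lambda>i. real (Suc k) + b i + real (kdelta i j) + 1) =
        (\<Prod>i=1..q. v i * Gamma (v i))"
      unfolding vGamma_def using G[OF v0]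
      by (intro prod.cong refl) (simp add: v_def add_ac)
    ultimately have step: "weight_coeff j (Suc k) =
        (\<Prod>i=1..p. u i) / (\<Prod>i=1..q. v i) * weight_coeff j k"
      unfolding weight_coeff_def by (simp add: prod.distrib vGamma_def u_def v_def)
    have split: "(\<Prod>i=1..q. v i) = (\<Prod>i\<in>{1..q} - {1..p}. v i) * (\<Prod>i=1..p. v i)"
      using p_less_q by (intro prod.subset_diff) auto
    have "card ({1..q} - {1..p}) = q - p"
      using p_less_q by (subst card_Diff_subset) auto
    then have "(2::real) ^ 1 \<le> (\<Prod>i\<in>{1..q} - {1..p}. 2)"
      using p_less_q by (simp only: prod_constant) (intro power_increasing, auto)
    also have "\<dots> \<le> (\<Prod>i\<in>{1..q} - {1..p}. v i)"
      using v by (intro prod_mono) auto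
    finally have "2 \<le> (\<Prod>i\<in>{1..q} - {1..p}. v i)" by simp
    moreover have "(\<Prod>i=1..p. u i) \<le> (\<Prod>i=1..p. v i)"
      using u uv by (intro prod_mono) (auto simp: less_imp_le)
    moreover have "(\<Prod>i=1..p. u i) > 0" using u by (intro prod_pos) auto
    ultimately have "2 * (\<Prod>i=1..p. u i) \<le> (\<Prod>i=1..q. v i)"
      unfolding split by (intro mult_mono) auto
    moreover have "(\<Prod>i=1..q. v i) > 0" using v0 by (intro prod_pos) auto
    ultimately have "(\<Prod>i=1..p. u i) / (\<Prod>i=1..q. v i) \<le> 1 / 2"
      by (simp add: divide_simps)
    moreover have "(\<Prod>i=1..p. u i) / (\<Prod>i=1..q. v i) \<ge> 0"
      using \<open>(\<Prod>i=1..p. u i) > 0\<close> \<open>(\<Prod>i=1..q. v i) > 0\<close> by simp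
    ultimately show "norm (weight_coeff j (Suc k)) \<le> 1 / 2 * norm (weight_coeff j k)"
      unfolding step norm_mult by (intro mult_right_mono) auto
  qed simp
  moreover have "weight_coeff j k \<ge> 0" for k
  proof -
    have "Gamma (real k + a i + 1) \<ge> 0" if "i \<in> {1..p}" for i
      using a_gt[OF that] by (intro less_imp_le Gamma_real_pos) simp
    moreover have "Gamma (real k + b i + real (kdelta i j) + 1) \<ge> 0" if "i \<in> {1..q}" for i
      using b_gt[OF that] by (intro less_imp_le Gamma_real_pos) simp
    ultimately show ?thesis
      unfolding weight_coeff_def vGamma_def by (intro divide_nonneg_nonneg prod_nonneg) auto
  qed
  ultimately show ?thesis by simp
qed

text \<open>The functional equation \<Gamma>(x + l) = \<Gamma>(x) (x)_l splits off the shift by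
  \<open>k\<close>; for the component \<open>j\<close> the shift is \<open>k + 1\<close>, which
  gives the extra factor \<open>s + b j + k\<close>. The index \<open>s - 1\<close> offsets the
  \<open>+ 1\<close> in the Gamma arguments of the weight.\<close>

lemma weight_coeff_shift:
  assumes j: "j \<in> {1..q}" and s: "s \<ge> 1"
  shows "weight_coeff j (s - 1 + k) =
    vGamma {1..p} (\<lambda>i. real s + a i) / vGamma {1..q} (\<lambda>i. real s + b i) * ratio_fn j k (real s)"
proof -
  have G: "Gamma (x + real l) = Gamma x * pochhammer x l" if "x > 0" for x l
  proof -
    have "x \<notin> \<int>\<^sub>\<le>\<^sub>0" using that by auto
    then show ?thesis using that by (simp add: pochhammer_Gamma Gamma_eq_zero_iff)
  qed
  have sk: "real (s - 1 + k) + x + 1 = real s + x + real k" for x using s by simp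
  have "vGamma {1..p} (\<lambda>i. real (s - 1 + k) + a i + 1) =
      vGamma {1..p} (\<lambda>i. real s + a i) * (\<Prod>i=1..p. pochhammer (real s + a i) k)"
    unfolding vGamma_def sk prod.distrib[symmetric]
  proof (intro prod.cong refl G)
    fix i assume "i \<in> {1..p}"
    then show "real s + a i > 0" using a_gt[of i] s by simp
  qed
  moreover have "vGamma {1..q} (\<lambda>i. real (s - 1 + k) + b i + real (kdelta i j) + 1) =
      vGamma {1..q} (\<lambda>i. real s + b i) * (\<Prod>i=1..q. pochhammer (real s + b i) k) *
        (real s + b j + real k)"
  proof -
    have pos: "real s + b i > 0" if "i \<in> {1..q}" for i using shift_b_pos[OF that] s by simp
    have "vGamma {1..q} (\<lambda>i. real (s - 1 + k) + b i + real (kdelta i j) + 1) =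
        (\<Prod>i=1..q. Gamma (real s + b i) * pochhammer (real s + b i) k *
          (if i = j then real s + b j + real k else 1))"
      unfolding vGamma_def
    proof (intro prod.cong refl)
      fix i assume i: "i \<in> {1..q}"
      have "real (s - 1 + k) + b i + real (kdelta i j) + 1 = real s + b i + real (k + kdelta i j)"
        using s by simp
      then show "Gamma (real (s - 1 + k) + b i + real (kdelta i j) + 1) =
          Gamma (real s + b i) * pochhammer (real s + b i) k *
          (if i = j then real s + b j + real k else 1)"
        using G[OF pos[OF i], of "k + kdelta i j"]
        by (cases "i = j") (simp_all add: kdelta_def pochhammer_Suc add_ac mult_ac)
    qed
    then show ?thesis using j by (simp add: prod.distrib prod.delta vGamma_def)
  qed
  ultimately show ?thesis by (simp add: weight_coeff_def ratio_fn_def mult_ac)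
qed

text \<open>The monomial \<open>z ^ k\<close> of \<open>A j\<close> moves the exponent from
  \<open>m\<close> to \<open>m + k\<close>, and the integral then picks out the Laurent coefficient
  of that index.\<close>

lemma contour_integral_type_I_form:
  assumes A: "\<And>j. j \<in> {1..q} \<Longrightarrow> degree (A j) \<le> n j - 1 \<and> (n j = 0 \<longrightarrow> A j = 0)"
  shows "contour_integral (circlepath 0 1) (\<lambda>z. z ^ m * type_I_form p q a b A z) =
    2 * of_real pi * \<i> * of_real (\<Sum>j=1..q. \<Sum>k<n j. coeff (A j) k * weight_coeff j (m + k))"
proof -
  have weight: "weight p q a b j z = (\<Sum>k. complex_of_real (weight_coeff j k) / z ^ (k + 1))" for j z
    by (simp add: weight_def weight_coeff_def)
  have "((\<lambda>z. \<Sum>j=1..q. \<Sum>k<n j. of_real (coeff (A j) k) * (z ^ (m + k) * weight p q a b j z))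
      has_contour_integral (\<Sum>j=1..q. \<Sum>k<n j. of_real (coeff (A j) k) *
        (2 * of_real pi * \<i> * of_real (weight_coeff j (m + k))))) (circlepath 0 1)"
    unfolding weight
    by (intro has_contour_integral_sum has_contour_integral_lmul
        has_contour_integral_Laurent_circle summable_weight_coeff) auto
  moreover have "(\<Sum>j=1..q. \<Sum>k<n j. of_real (coeff (A j) k) * (z ^ (m + k) * weight p q a b j z)) =
      z ^ m * type_I_form p q a b A z" for z
  proof -
    have regroup: "of_real (coeff (A j) k) * (z ^ (m + k) * weight p q a b j z) =
        z ^ m * ((of_real (coeff (A j) k) * z ^ k) * weight p q a b j z)" for j k
      by (simp add: power_add mult_ac)
    have "poly (map_poly complex_of_real (A j)) z = (\<Sum>k<n j. of_real (coeff (A j) k) * z ^ k)"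
      if "j \<in> {1..q}" for j
      using A[OF that] by (intro poly_map_poly_of_real_lessThan) auto
    then have "type_I_form p q a b A z =
        (\<Sum>j=1..q. (\<Sum>k<n j. of_real (coeff (A j) k) * z ^ k) * weight p q a b j z)"
      unfolding type_I_form_def by (intro sum.cong) simp_all
    then show ?thesis
      by (simp only: regroup sum_distrib_left sum_distrib_right)
  qed
  ultimately show ?thesis
    by (simp add: contour_integral_unique sum_distrib_left mult_ac)
qed

lemma type_I_moments:
  assumes A: "type_I p q a b n A" and norm: "normalized p q a b n A" and s: "s \<ge> 1"
  shows "(\<Sum>j=1..q. \<Sum>k<n j. coeff (A j) k * ratio_fn j k (real s)) =
    pochhammer (1 - real s) (msize q n - 1) / (\<Prod>i=1..q. pochhammer (real s + b i) (n i))"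
proof -
  define g where "g = vGamma {1..p} (\<lambda>i. real s + a i) / vGamma {1..q} (\<lambda>i. real s + b i)"
  have deg: "degree (A j) \<le> n j - 1 \<and> (n j = 0 \<longrightarrow> A j = 0)" if "j \<in> {1..q}" for j
    using A that by (simp add: type_I_def)
  have a_pos: "real s + a i > 0" if "i \<in> {1..p}" for i using a_gt[OF that] s by simp
  have b_pos: "real s + b i > 0" if "i \<in> {1..q}" for i using b_gt[OF that] s by simp
  \<comment> \<open>All Gamma arguments are positive for \<open>s \<ge> 1\<close>, so this common
    factor can be divided out.\<close>
  have g: "g \<noteq> 0"
    using Gamma_real_pos[OF a_pos] Gamma_real_pos[OF b_pos]
    by (auto simp: g_def vGamma_def less_le)
  have Gb: "Gamma (real s + b i + real (n i)) = Gamma (real s + b i) * pochhammer (real s + b i) (n i)"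
    if "i \<in> {1..q}" for i
  proof -
    have "real s + b i \<notin> \<int>\<^sub>\<le>\<^sub>0" using b_pos[OF that] by auto
    then show ?thesis by (simp add: pochhammer_Gamma Gamma_eq_zero_iff)
  qed
  have "complex_of_real (\<Sum>j=1..q. \<Sum>k<n j. coeff (A j) k * weight_coeff j (s - 1 + k)) =
      complex_of_real (vGamma {1..p} (\<lambda>i. real s + a i) /
        vGamma {1..q} (\<lambda>i. real s + b i + real (n i)) * pochhammer (1 - real s) (msize q n - 1))"
  proof -
    have "contour_integral (circlepath 0 1) (\<lambda>z. z ^ (s - 1) * type_I_form p q a b A z) =
        2 * of_real pi * \<i> * of_real (\<Sum>j=1..q. \<Sum>k<n j. coeff (A j) k * weight_coeff j (s - 1 + k))"
      by (rule contour_integral_type_I_form) (rule deg)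
    moreover have "1 / (2 * complex_of_real pi * \<i>) *
        contour_integral (circlepath 0 1) (\<lambda>z. z ^ (s - 1) * type_I_form p q a b A z) =
        complex_of_real (vGamma {1..p} (\<lambda>i. real s + a i) /
        vGamma {1..q} (\<lambda>i. real s + b i + real (n i)) * pochhammer (1 - real s) (msize q n - 1))"
      using norm s unfolding normalized_def by blast
    moreover have "1 / (2 * complex_of_real pi * \<i>) * (2 * of_real pi * \<i> * w) = w" for w
      by simp
    ultimately show ?thesis by (simp only:)
  qed
  then have "(\<Sum>j=1..q. \<Sum>k<n j. coeff (A j) k * weight_coeff j (s - 1 + k)) =
      vGamma {1..p} (\<lambda>i. real s + a i) /
        vGamma {1..q} (\<lambda>i. real s + b i + real (n i)) * pochhammer (1 - real s) (msize q n - 1)"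
    by (simp only: of_real_eq_iff)
  also have "vGamma {1..q} (\<lambda>i. real s + b i + real (n i)) =
      vGamma {1..q} (\<lambda>i. real s + b i) * (\<Prod>i=1..q. pochhammer (real s + b i) (n i))"
    by (simp add: vGamma_def Gb prod.distrib)
  also have "(\<Sum>j=1..q. \<Sum>k<n j. coeff (A j) k * weight_coeff j (s - 1 + k)) =
      g * (\<Sum>j=1..q. \<Sum>k<n j. coeff (A j) k * ratio_fn j k (real s))"
    unfolding sum_distrib_left
    by (intro sum.cong refl) (simp only: weight_coeff_shift[OF _ s] g_def mult_ac)
  finally have "g * (\<Sum>j=1..q. \<Sum>k<n j. coeff (A j) k * ratio_fn j k (real s)) =
      g * (pochhammer (1 - real s) (msize q n - 1) / (\<Prod>i=1..q. pochhammer (real s + b i) (n i)))"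
    by (simp add: g_def)
  then show ?thesis by (simp only: mult_left_cancel[OF g])
qed

section \<open>Comparison of coefficients\<close>

text \<open>Inserting the expansion of each \<open>1 / (s + b J + K)\<close> into the partial
  fractions yields coefficients \<open>d\<close> with the same moments as \<open>c\<close>; linear
  independence of the \<open>ratio_fn\<close> forces \<open>c = d\<close>.\<close>

lemma moments_determine_coefficients:
  assumes diag: "near_diagonal q n" and N: "msize q n \<ge> 1"
    and mom: "\<And>s::nat. s \<ge> 1 \<Longrightarrow> (\<Sum>j=1..q. \<Sum>k<n j. c j k * ratio_fn j k (real s)) =
      pochhammer (1 - real s) (msize q n - 1) / (\<Prod>i=1..q. pochhammer (real s + b i) (n i))"
    and j: "j \<in> {1..q}" and k: "k < n j"
  shows "c j k = (\<Sum>J=1..q. \<Sum>K<n J. coeffP q b n J K *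
    (if k < K + kdelta j J then expansion_coeff j J K k else 0))"
proof -
  \<comment> \<open>Extension by zero gives all sums the same index set \<open>W\<close>, so that
    they can be interchanged.\<close>
  define e where "e j J K k = (if k < K + kdelta j J then expansion_coeff j J K k else 0)" for j J K k
  define d where "d j k = (\<Sum>J=1..q. \<Sum>K<n J. coeffP q b n J K * e j J K k)" for j k
  define W where "W = (SIGMA j:{1..q}. {..<n j})"
  have W: "(\<Sum>j=1..q. \<Sum>k<n j. F j k) = (\<Sum>(j, k)\<in>W. F j k)" for F :: "nat \<Rightarrow> nat \<Rightarrow> real"
    unfolding W_def by (rule sum.Sigma) simp_all
  have "(\<Sum>j=1..q. \<Sum>k<n j. (c j k - d j k) * ratio_fn j k (real s)) = 0" if s: "s \<ge> 1" for s :: nat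
  proof -
    have "(\<Sum>j=1..q. \<Sum>k<n j. d j k * ratio_fn j k (real s)) =
        (\<Sum>v\<in>W. \<Sum>u\<in>W. coeffP q b n (fst u) (snd u) *
          (e (fst v) (fst u) (snd u) (snd v) * ratio_fn (fst v) (snd v) (real s)))"
      unfolding d_def W by (simp add: case_prod_unfold sum_distrib_right mult.assoc)
    also have "\<dots> = (\<Sum>u\<in>W. \<Sum>v\<in>W. coeffP q b n (fst u) (snd u) *
          (e (fst v) (fst u) (snd u) (snd v) * ratio_fn (fst v) (snd v) (real s)))"
      by (rule sum.swap)
    also have "\<dots> = (\<Sum>J=1..q. \<Sum>K<n J. coeffP q b n J K *
        (\<Sum>j=1..q. \<Sum>k<n j. e j J K k * ratio_fn j k (real s)))"
      unfolding W by (simp add: case_prod_unfold sum_distrib_left)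
    also have "\<dots> = (\<Sum>J=1..q. \<Sum>K<n J. coeffP q b n J K / (real s + b J + real K))"
    proof (intro sum.cong refl)
      fix J K assume J: "J \<in> {1..q}" and "K \<in> {..<n J}"
      then have K: "K < n J" by simp
      \<comment> \<open>The index bound ensures that the cutoff at \<open>n j\<close> loses no term
        of the expansion.\<close>
      have "(\<Sum>k<n j. e j J K k * ratio_fn j k (real s)) =
          (\<Sum>k<K + kdelta j J. expansion_coeff j J K k * ratio_fn j k (real s))"
        if j: "j \<in> {1..q}" for j
        using near_diagonal_index_bound[OF diag j J K]
        by (intro sum.mono_neutral_cong_right) (auto simp: e_def)
      then show "coeffP q b n J K * (\<Sum>j=1..q. \<Sum>k<n j. e j J K k * ratio_fn j k (real s)) =
          coeffP q b n J K / (real s + b J + real K)"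
        using inverse_linear_expansion[OF J, of "real s" K] s by (simp add: divide_inverse)
    qed
    finally show ?thesis
      using mom[OF s] moment_partial_fractions[OF N, of "real s"] s
      by (simp add: left_diff_distrib sum_subtractf)
  qed
  then have "c j k - d j k = 0"
    using j k by (rule ratio_fn_independent)
  then show ?thesis by (simp add: d_def e_def)
qed

end

section \<open>The explicit type I polynomials\<close>

theorem theorem4p4:
  fixes p q :: nat and a b :: "nat \<Rightarrow> real" and n :: "nat \<Rightarrow> nat"
    and A :: "nat \<Rightarrow> real poly"
  assumes "p < q"
    and "\<forall>i\<in>{1..p}. a i > -1"
    and "\<forall>j\<in>{1..q}. b j > -1"
    and "\<forall>j\<in>{1..p}. a j < b j"
    and "near_diagonal q n"
    and "msize q n \<ge> 1"
    and "\<forall>i\<in>{1..p}. \<forall>j\<in>{1..q}. i \<noteq> j \<longrightarrow> b j - a i \<notin> {x \<in> \<int>. x < 0}"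
    and "\<forall>i\<in>{1..q}. \<forall>j\<in>{1..q}. i \<noteq> j \<longrightarrow> b i - b j \<notin> \<nat>"
    and "type_I p q a b n A"
    and "normalized p q a b n A"
  shows "\<forall>j\<in>{1..q}. \<forall>z::complex.
    poly (map_poly complex_of_real (A j)) z =
      complex_of_real (1 / vpoch ({1..q} - {j}) (\<lambda>i. b i - b j) 1) *
      (\<Sum>J=1..q. \<Sum>K<n J. complex_of_real (coeffP q b n J K) *
        (\<Sum>k<K + kdelta j J.
           complex_of_real
             (a_quot p a b j J K k *
              vpoch ({1..q} - {j}) (\<lambda>i. b i - b J - real K) (k + 1) *
              pochhammer (b j - b J - real K) k) * z ^ k))"
proof (intro ballI allI)
  fix j and z :: complex assume j: "j \<in> {1..q}"
  interpret mixed_parameters p q a b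
  proof
    \<comment> \<open>For \<open>i \<noteq> j\<close> this is the separation hypothesis; for
      \<open>i = j\<close> it follows from \<open>a j < b j\<close>.\<close>
    show "a i \<noteq> b j + real m" if "i \<in> {1..p}" "j \<in> {1..q}" "m \<ge> 1" for i j m
    proof
      assume eq: "a i = b j + real m"
      then have "b j - a i = of_int (- int m)" by simp
      then have "b j - a i \<in> \<int>" by (metis Ints_of_int)
      moreover have "b j - a i < 0" using eq that by simp
      moreover have "i \<noteq> j" using eq assms(4) that by fastforce
      ultimately show False using assms(7) that by blast
    qed
    \<comment> \<open>The hypothesis applied to both orders of the pair excludes integers of either
      sign.\<close>
    show "b i - b j \<notin> \<int>" if "i \<in> {1..q}" "j \<in> {1..q}" "i \<noteq> j" for i j
    proof
      assume "b i - b j \<in> \<int>"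
      then obtain l where l: "b i - b j = of_int l" by (auto elim: Ints_cases)
      show False
      proof (cases "l \<ge> 0")
        case True
        then have "b i - b j = of_nat (nat l)" using l by simp
        then show False using assms(8) that by (metis of_nat_in_Nats)
      next
        case False
        then have "b j - b i = of_nat (nat (- l))" using l by simp
        then show False using assms(8) that by (metis of_nat_in_Nats)
      qed
    qed
  qed (use assms in auto)
  define v where "v = vpoch ({1..q} - {j}) (\<lambda>i. b i - b j) 1"
  define M where "M J K k = a_quot p a b j J K k *
    vpoch ({1..q} - {j}) (\<lambda>i. b i - b J - real K) (k + 1) * pochhammer (b j - b J - real K) k" for J K k
  have M: "expansion_coeff j J K k = M J K k / v" for J K k
    by (simp add: expansion_coeff_def M_def v_def)
  have coeff: "coeff (A j) k = (\<Sum>J=1..q. \<Sum>K<n J. coeffP q b n J K *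
      (if k < K + kdelta j J then M J K k / v else 0))" if "k < n j" for k
    using moments_determine_coefficients[OF assms(5,6) type_I_moments[OF assms(9,10)] j that]
    unfolding M .
  have "degree (A j) \<le> n j - 1" "n j = 0 \<longrightarrow> A j = 0"
    using assms(9) j by (simp_all add: type_I_def)
  then have "poly (map_poly complex_of_real (A j)) z =
      (\<Sum>k<n j. complex_of_real (coeff (A j) k) * z ^ k)"
    by (rule poly_map_poly_of_real_lessThan)
  also have "\<dots> = (\<Sum>k<n j. \<Sum>J=1..q. \<Sum>K<n J. complex_of_real (coeffP q b n J K) *
      (complex_of_real (if k < K + kdelta j J then M J K k / v else 0) * z ^ k))"
  proof (rule sum.cong[OF refl])
    fix k assume "k \<in> {..<n j}"
    then have k: "k < n j" by simp
    show "complex_of_real (coeff (A j) k) * z ^ k =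
        (\<Sum>J=1..q. \<Sum>K<n J. complex_of_real (coeffP q b n J K) *
          (complex_of_real (if k < K + kdelta j J then M J K k / v else 0) * z ^ k))"
      by (simp only: coeff[OF k] of_real_sum of_real_mult sum_distrib_right mult.assoc)
  qed
  \<comment> \<open>With the sum over \<open>k\<close> innermost, its range can be cut to
    \<open>K + kdelta j J\<close> for each pair \<open>J\<close>, \<open>K\<close>.\<close>
  also have "\<dots> = (\<Sum>J=1..q. \<Sum>K<n J. \<Sum>k<n j. complex_of_real (coeffP q b n J K) *
      (complex_of_real (if k < K + kdelta j J then M J K k / v else 0) * z ^ k))"
    by (subst sum.swap) (intro sum.cong refl sum.swap)
  also have "\<dots> = (\<Sum>J=1..q. \<Sum>K<n J. complex_of_real (1 / v) * (complex_of_real (coeffP q b n J K) *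
      (\<Sum>k<K + kdelta j J. complex_of_real (M J K k) * z ^ k)))"
  proof (intro sum.cong refl)
    fix J K assume J: "J \<in> {1..q}" and K: "K \<in> {..<n J}"
    have "(\<Sum>k<n j. complex_of_real (if k < K + kdelta j J then M J K k / v else 0) * z ^ k) =
        (\<Sum>k<K + kdelta j J. complex_of_real (M J K k / v) * z ^ k)"
      using near_diagonal_index_bound[OF assms(5) j J] K
      by (intro sum.mono_neutral_cong_right) auto
    also have "\<dots> = complex_of_real (1 / v) * (\<Sum>k<K + kdelta j J. complex_of_real (M J K k) * z ^ k)"
      by (simp add: sum_distrib_left)
    finally have inner: "(\<Sum>k<n j. complex_of_real (if k < K + kdelta j J then M J K k / v else 0) * z ^ k) =
        complex_of_real (1 / v) * (\<Sum>k<K + kdelta j J. complex_of_real (M J K k) * z ^ k)" .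
    show "(\<Sum>k<n j. complex_of_real (coeffP q b n J K) *
        (complex_of_real (if k < K + kdelta j J then M J K k / v else 0) * z ^ k)) =
        complex_of_real (1 / v) * (complex_of_real (coeffP q b n J K) *
        (\<Sum>k<K + kdelta j J. complex_of_real (M J K k) * z ^ k))"
      unfolding sum_distrib_left[symmetric] inner by (rule mult.left_commute)
  qed
  also have "\<dots> = complex_of_real (1 / v) * (\<Sum>J=1..q. \<Sum>K<n J. complex_of_real (coeffP q b n J K) *
      (\<Sum>k<K + kdelta j J. complex_of_real (M J K k) * z ^ k))"
    by (simp only: sum_distrib_left)
  finally show "poly (map_poly complex_of_real (A j)) z =
      complex_of_real (1 / vpoch ({1..q} - {j}) (\<lambda>i. b i - b j) 1) *
      (\<Sum>J=1..q. \<Sum>K<n J. complex_of_real (coeffP q b n J K) *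
        (\<Sum>k<K + kdelta j J.
           complex_of_real
             (a_quot p a b j J K k *
              vpoch ({1..q} - {j}) (\<lambda>i. b i - b J - real K) (k + 1) *
              pochhammer (b j - b J - real K) k) * z ^ k))"
    unfolding v_def M_def .
qed

end
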